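(* Let $n$ be a positive integer. For any two subsets $I,J\subseteq[n-1]$ with the same associated partition, there exists a bijection between $\{\pi\in\mathcal{S}_n : D(\pi)\subseteq I\}$ and $\{\sigma\in\mathcal{S}_n : D(\sigma)\subseteq J\}$ that preserves the cycle structure.
   Context: $[n]=\{1,\dots,n\}$; $\mathcal{S}_n$ is the set of permutations of $[n]$; $D(\pi)=\{i : 1\le i\le n-1,\ \pi(i)>\pi(i+1)\}$. The cycle structure of a permutation is the partition of $n$ whose parts are the lengths of its cycles (fixed points included). For $I=\{i_1<i_2<\dots<i_k\}\subseteq[n-1]$, the associated composition of $n$ is $(i_1,i_2-i_1,\dots,i_k-i_{k-1},n-i_k)$, and the associated partition of $I$ is the partition of $n$ obtained by listing the parts of this composition in non-increasing order. *)

theory Defs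
  imports "HOL-Combinatorics.Orbits" "HOL-Library.Multiset"
begin

text \<open>
  The symmetric group on \<open>[n] = {1..n}\<close> is the set of functions \<open>p :: nat \<Rightarrow> nat\<close> with
  \<open>p permutes {1..n}\<close>; these are the identity outside \<open>{1..n}\<close>.
  A partition of \<open>n\<close> is represented by the non-increasing list of its parts.
\<close>

definition descent_set :: "nat \<Rightarrow> (nat \<Rightarrow> nat) \<Rightarrow> nat set" where
  "descent_set n p = {i. 1 \<le> i \<and> i \<le> n - 1 \<and> p i > p (i + 1)}"

text \<open>
  The cycles of \<open>p\<close> on \<open>{1..n}\<close> are its orbits, and the length of a cycle is the cardinality of
  the orbit. Cycles are collected as a set before passing to the multiset of their lengths, so
  each cycle counts once and distinct cycles of equal length are all counted.
\<close>

definition cycle_structure :: "nat \<Rightarrow> (nat \<Rightarrow> nat) \<Rightarrow> nat list" where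
  "cycle_structure n p =
     rev (sorted_list_of_multiset (image_mset card (mset_set (orbit p ` {1..n}))))"

text \<open>
  With \<open>I = {i\<^sub>1 < \<dots> < i\<^sub>k}\<close>, these are the consecutive differences of \<open>0, i\<^sub>1, \<dots>, i\<^sub>k, n\<close>.
  Subtraction on \<^typ>\<open>nat\<close> does not truncate here when \<open>I \<subseteq> {1..n - 1}\<close>. For \<open>I = {}\<close> the
  composition is \<open>[n]\<close>.
\<close>

definition associated_composition :: "nat \<Rightarrow> nat set \<Rightarrow> nat list" where
  "associated_composition n I =
     (let xs = sorted_list_of_set I in map2 (\<lambda>a b. b - a) (0 # xs) (xs @ [n]))"

definition associated_partition :: "nat \<Rightarrow> nat set \<Rightarrow> nat list" where
  "associated_partition n I = rev (sort (associated_composition n I))"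

end

theory Submission
  imports Defs "HOL-Combinatorics.Cycles" "HOL-Library.List_Lexorder"
begin

text \<open>
  The argument is that of Gessel and Reutenauer, with multisets of primitive necklaces replaced by
  conjugacy orbits of labelled permutations. Label each point by the index of its block; then
  \<open>D(p) \<subseteq> I\<close> says that \<open>p\<close> is increasing on every block. The itinerary of a point is the sequence of
  labels along its cycle. For such a \<open>p\<close> distinct points of a cycle have distinct itineraries, and
  this property depends on the labelling only up to an injective renaming of labels. Conversely, a
  labelled permutation with this property has exactly one conjugate that is increasing on blocks
  of the prescribed order, obtained by sorting the points by itinerary. So one can rename the
  labels such that the block sizes of \<open>I\<close> become those of \<open>J\<close>, and sort again.
\<close>

section \<open>Monotone maps and ranks\<close>

text \<open>Along the sorted enumeration of \<open>A\<close> both functions yield sorted lists with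
  the same multiset of entries, and such a list is unique.\<close>

lemma mono_on_eqI:
  fixes f g :: "'a::linorder \<Rightarrow> 'b::linorder"
  assumes "finite A" "mono_on A f" "mono_on A g"
    and ms: "image_mset f (mset_set A) = image_mset g (mset_set A)" and "x \<in> A"
  shows "f x = g x"
proof -
  let ?L = "sorted_list_of_set A"
  have s: "sorted (map h ?L)" if "mono_on A h" for h :: "'a \<Rightarrow> 'b"
    unfolding sorted_map
    by (rule sorted_wrt_mono_rel[OF _ sorted_sorted_list_of_set[of A]])
      (use that assms(1) in \<open>auto simp: mono_on_def\<close>)
  have m: "mset ?L = mset_set A"
    by (metis mset_sorted_list_of_multiset sorted_list_of_mset_set)
  have "mset (map f ?L) = mset (map g ?L)"
    using ms m by simp
  then have "map f ?L = map g ?L"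
    using s assms(2,3) by (metis properties_for_sort)
  then show ?thesis using assms(1) \<open>x \<in> A\<close> by simp
qed

lemma image_mset_comp_permutes:
  assumes "p permutes A"
  shows "image_mset (f \<circ> p) (mset_set A) = image_mset f (mset_set A)"
  by (simp add: permutes_image_mset[OF assms] flip: multiset.map_comp)

text \<open>The witness sends a point to the number of points whose key is at most its own;
  injectivity of \<open>key\<close> rules out ties.\<close>

lemma exists_ranking_permutation:
  fixes key :: "nat \<Rightarrow> 'a::linorder"
  assumes "inj_on key {1..n}"
  obtains \<sigma> where "\<sigma> permutes {1..n}"
    and "\<And>i j. \<lbrakk>i \<in> {1..n}; j \<in> {1..n}\<rbrakk> \<Longrightarrow> \<sigma> i < \<sigma> j \<longleftrightarrow> key i < key j"
proof -
  define r where "r i = card {j \<in> {1..n}. key j \<le> key i}" for i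
  define \<sigma> where "\<sigma> i = (if i \<in> {1..n} then r i else i)" for i
  have less: "r i < r j" if "i \<in> {1..n}" "j \<in> {1..n}" "key i < key j" for i j
    unfolding r_def
  proof (rule psubset_card_mono)
    have "j \<notin> {l \<in> {1..n}. key l \<le> key i}" "j \<in> {l \<in> {1..n}. key l \<le> key j}"
      using that by auto
    then show "{l \<in> {1..n}. key l \<le> key i} \<subset> {l \<in> {1..n}. key l \<le> key j}"
      using that(3) by auto
  qed simp
  have iff: "\<sigma> i < \<sigma> j \<longleftrightarrow> key i < key j" if "i \<in> {1..n}" "j \<in> {1..n}" for i j
  proof (cases "key i" "key j" rule: linorder_cases)
    case equal
    then have "i = j" using assms that by (simp add: inj_on_eq_iff)
    then show ?thesis by simp
  next
    case greater
    then have "r j < r i" by (rule less[OF that(2,1)])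
    then show ?thesis using greater that by (simp add: \<sigma>_def)
  qed (use less[OF that] that in \<open>simp add: \<sigma>_def\<close>)
  have inj: "inj_on \<sigma> {1..n}"
  proof (rule inj_onI)
    fix i j assume ij: "i \<in> {1..n}" "j \<in> {1..n}" "\<sigma> i = \<sigma> j"
    then have "key i = key j"
      using iff[OF ij(1,2)] iff[OF ij(2,1)] by (metis less_irrefl linorder_neqE)
    then show "i = j" using inj_onD[OF assms] ij by blast
  qed
  have "\<sigma> i \<in> {1..n}" if "i \<in> {1..n}" for i
  proof -
    have "r i \<le> card {1..n}" unfolding r_def by (rule card_mono) auto
    moreover have "r i > 0" unfolding r_def card_gt_0_iff using that by auto
    ultimately show ?thesis using that by (auto simp: \<sigma>_def)
  qed
  then have "\<sigma> ` {1..n} = {1..n}"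
    by (intro endo_inj_surj inj) auto
  then have "bij_betw \<sigma> {1..n} {1..n}"
    using inj by (simp add: bij_betw_def)
  then have "\<sigma> permutes {1..n}"
    by (rule bij_imp_permutes) (auto simp: \<sigma>_def)
  then show thesis using that iff by blast
qed

section \<open>Conjugation\<close>

lemma funpow_conjugate:
  assumes "bij \<sigma>"
  shows "((\<sigma> \<circ> p \<circ> inv \<sigma>) ^^ t) (\<sigma> i) = \<sigma> ((p ^^ t) i)"
  using assms by (induction t) (simp_all add: bij_is_inj)

lemma orbit_conjugate:
  assumes "bij \<sigma>"
  shows "orbit (\<sigma> \<circ> p \<circ> inv \<sigma>) (\<sigma> i) = \<sigma> ` orbit p i"
  unfolding orbit_altdef funpow_conjugate[OF assms] by auto

text \<open>Conjugation by \<open>\<sigma>\<close> carries the set of orbits bijectively, via images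
  under \<open>\<sigma>\<close>, onto the set of new orbits and keeps their sizes.\<close>

lemma cycle_structure_conjugate:
  assumes "\<sigma> permutes {1..n}"
  shows "cycle_structure n (\<sigma> \<circ> p \<circ> inv \<sigma>) = cycle_structure n p"
proof -
  have b: "bij \<sigma>" using assms by (rule permutes_bij)
  then have inj: "inj \<sigma>" by (rule bij_is_inj)
  have "orbit (\<sigma> \<circ> p \<circ> inv \<sigma>) ` {1..n} = orbit (\<sigma> \<circ> p \<circ> inv \<sigma>) ` (\<sigma> ` {1..n})"
    by (simp only: permutes_image[OF assms])
  also have "\<dots> = image \<sigma> ` orbit p ` {1..n}"
    by (simp only: image_image orbit_conjugate[OF b])
  finally have eq: "orbit (\<sigma> \<circ> p \<circ> inv \<sigma>) ` {1..n} = image \<sigma> ` orbit p ` {1..n}" .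
  have "inj_on (image \<sigma>) (orbit p ` {1..n})"
    using inj by (simp add: inj_on_def inj_image_eq_iff)
  then have "mset_set (image \<sigma> ` orbit p ` {1..n}) =
      image_mset (image \<sigma>) (mset_set (orbit p ` {1..n}))"
    by (simp add: image_mset_mset_set)
  then show ?thesis
    unfolding cycle_structure_def eq
    by (simp add: multiset.map_comp comp_def card_image[OF inj_on_subset[OF inj subset_UNIV]])
qed

section \<open>Itineraries\<close>

text \<open>Itineraries are truncated to finite lists so that the lexicographic order on lists can
  compare them; over a full period nothing is lost.\<close>

primrec word :: "('a \<Rightarrow> 'a) \<Rightarrow> ('a \<Rightarrow> 'b) \<Rightarrow> nat \<Rightarrow> 'a \<Rightarrow> 'b list" where
  "word p w 0 i = []"
| "word p w (Suc m) i = w i # word p w m (p i)"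

lemma length_word [simp]: "length (word p w m i) = m"
  by (induction m arbitrary: i) auto

lemma nth_word: "t < m \<Longrightarrow> word p w m i ! t = w ((p ^^ t) i)"
proof (induction m arbitrary: i t)
  case (Suc m)
  then show ?case by (cases t) (simp_all add: funpow_swap1)
qed simp

lemma word_snoc: "word p w (Suc m) i = word p w m i @ [w ((p ^^ m) i)]"
proof (induction m arbitrary: i)
  case (Suc m)
  have "word p w (Suc (Suc m)) i = w i # word p w (Suc m) (p i)" by simp
  also have "\<dots> = w i # word p w m (p i) @ [w ((p ^^ m) (p i))]"
    by (simp only: Suc.IH)
  finally show ?case by (simp add: funpow_swap1)
qed simp

lemma append_less_append_iff:
  fixes xs ys :: "'a::linorder list"
  assumes "length xs = length ys"
  shows "xs @ us < ys @ vs \<longleftrightarrow> xs < ys \<or> xs = ys \<and> us < vs"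
  using assms by (induction rule: list_induct2) auto

text \<open>Labels are compared only for equality, so the condition depends on the level sets of
  \<open>w\<close> alone.\<close>

definition increasing_on_levels :: "nat \<Rightarrow> (nat \<Rightarrow> 'a) \<Rightarrow> (nat \<Rightarrow> nat) \<Rightarrow> bool" where
  "increasing_on_levels n w p \<longleftrightarrow>
     (\<forall>i\<in>{1..n}. \<forall>j\<in>{1..n}. i < j \<and> w i = w j \<longrightarrow> p i < p j)"

text \<open>In terms of necklaces: the label word read around each cycle is primitive, that is, not
  a proper power.\<close>

definition primitive_labelling :: "nat \<Rightarrow> (nat \<Rightarrow> nat) \<Rightarrow> (nat \<Rightarrow> 'a) \<Rightarrow> bool" where
  "primitive_labelling n p w \<longleftrightarrow>
     (\<forall>i\<in>{1..n}. \<forall>j\<in>orbit p i. (\<forall>t. w ((p ^^ t) i) = w ((p ^^ t) j)) \<longrightarrow> i = j)"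

lemma funpow_in_interval:
  assumes "p permutes {1..n}" "i \<in> {1..n}"
  shows "(p ^^ t) i \<in> {1..n}"
  using permutes_in_image[OF permutes_funpow[OF assms(1)]] assms(2) by blast

text \<open>The form \<open>Suc m\<close> makes the period positive and makes \<open>p ^^ m\<close>
  the inverse of \<open>p\<close>.\<close>

lemma obtain_period:
  assumes "p permutes {1..n::nat}"
  obtains m where "p ^^ Suc m = id"
proof -
  have "permutation p" using assms permutation_permutes by blast
  then obtain N where "p ^^ N = id" "N > 0" by (rule permutation_is_nilpotent)
  then show thesis using that by (cases N) auto
qed

text \<open>
  If two points of a cycle had the same itinerary, then \<open>p ^^ d\<close> would move every point of the
  sequence \<open>i, (p ^^ d) i, (p ^^ (2 * d)) i, \<dots>\<close> in the same direction, so it could not return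
  to \<open>i\<close>.
\<close>

lemma increasing_on_levels_imp_primitive:
  assumes p: "p permutes {1..n}" and inc: "increasing_on_levels n w p"
  shows "primitive_labelling n p w"
  unfolding primitive_labelling_def
proof (intro ballI impI)
  fix i j
  assume i: "i \<in> {1..n}" and "j \<in> orbit p i"
    and w: "\<forall>t. w ((p ^^ t) i) = w ((p ^^ t) j)"
  then obtain d where j: "j = (p ^^ d) i" by (auto simp: orbit_altdef)
  then have jn: "j \<in> {1..n}" using funpow_in_interval[OF p i] by simp
  obtain m where m: "p ^^ Suc m = id" using obtain_period[OF p] .
  have keep: "(p ^^ t) x < (p ^^ t) y"
    if "x \<in> {1..n}" "y \<in> {1..n}" "\<forall>t. w ((p ^^ t) x) = w ((p ^^ t) y)" "x < y" for t x y
  proof (induction t)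
    case (Suc t)
    then show ?case
      using inc that funpow_in_interval[OF p] by (simp add: increasing_on_levels_def)
  qed (use that in simp)
  define s where "s k = (p ^^ (k * d)) i" for k
  have s0: "s 0 = i" by (simp add: s_def)
  have step: "(p ^^ (k * d)) j = s (Suc k)" for k
    using funpow_add[of "k * d" d p] by (simp add: s_def j add.commute)
  have "s (Suc m) = ((p ^^ Suc m) ^^ d) i"
    unfolding s_def funpow_mult by (simp add: mult.commute)
  then have sN: "s (Suc m) = i" by (simp only: m) simp
  show "i = j"
  proof (cases i j rule: linorder_cases)
    case less
    have "s k < s (Suc k)" for k
      using keep[OF i jn w less, of "k * d"] step[of k] by (simp add: s_def)
    then have "s 0 < s (Suc m)" by (meson lift_Suc_mono_less zero_less_Suc)
    then show ?thesis using s0 sN by simp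
  next
    case greater
    have "s (Suc k) < s k" for k
      using keep[OF jn i _ greater, of "k * d"] w step[of k] by (simp add: s_def)
    then have "s (Suc m) < s 0"
      by (induction m) (auto intro: less_trans)
    then show ?thesis using s0 sN by simp
  qed
qed

text \<open>Either the first labels already differ in the right direction, or they agree and
  \<open>p\<close> preserves the order of the two points, so induction applies to their
  images.\<close>

lemma mono_on_word:
  fixes w :: "nat \<Rightarrow> 'a::linorder"
  assumes p: "p permutes {1..n}" and inc: "increasing_on_levels n w p"
    and mono: "mono_on {1..n} w"
  shows "mono_on {1..n} (word p w m)"
proof -
  have "word p w m i \<le> word p w m j" if "i \<in> {1..n}" "j \<in> {1..n}" "i \<le> j" for i j
    using that
  proof (induction m arbitrary: i j)
    case (Suc m)
    have in_n: "p i \<in> {1..n}" "p j \<in> {1..n}"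
      using Suc.prems permutes_in_image[OF p] by blast+
    have "w i \<le> w j" using mono_onD[OF mono] Suc.prems by blast
    moreover have "word p w m (p i) \<le> word p w m (p j)" if "w i = w j"
    proof (rule Suc.IH[OF in_n])
      show "p i \<le> p j"
        using inc that Suc.prems by (cases "i = j") (auto simp: increasing_on_levels_def less_imp_le)
    qed
    ultimately show ?case by auto
  qed simp
  then show ?thesis by (auto intro: mono_onI)
qed

lemma word_conjugate:
  assumes "\<sigma> permutes {1..n}" "p permutes {1..n}" "i \<in> {1..n}"
    and lab: "\<And>k. k \<in> {1..n} \<Longrightarrow> w (\<sigma> k) = u k"
  shows "word (\<sigma> \<circ> p \<circ> inv \<sigma>) w m (\<sigma> i) = word p u m i"
proof (rule nth_equalityI)
  fix t assume "t < length (word (\<sigma> \<circ> p \<circ> inv \<sigma>) w m (\<sigma> i))"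
  then have "t < m" by simp
  then show "word (\<sigma> \<circ> p \<circ> inv \<sigma>) w m (\<sigma> i) ! t = word p u m i ! t"
    by (simp only: nth_word funpow_conjugate[OF permutes_bij[OF assms(1)]]
        lab[OF funpow_in_interval[OF assms(2,3)]])
qed simp

text \<open>
  Both families of itineraries are weakly increasing and agree as multisets, hence agree.
  An itinerary over a full period ends with the label of the preimage, and \<open>p\<close> is determined by
  these labels because it is increasing on the level sets of \<open>w\<close>.
\<close>

lemma conjugate_increasing_on_levels_unique:
  fixes w :: "nat \<Rightarrow> 'a::linorder"
  assumes p: "p permutes {1..n}" and ip: "increasing_on_levels n w p"
    and mono: "mono_on {1..n} w"
    and \<sigma>: "\<sigma> permutes {1..n}" and lab: "\<And>i. i \<in> {1..n} \<Longrightarrow> w (\<sigma> i) = w i"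
    and q: "q = \<sigma> \<circ> p \<circ> inv \<sigma>" and iq: "increasing_on_levels n w q"
  shows "p = q"
proof -
  have qp: "q permutes {1..n}"
    unfolding q by (intro permutes_compose permutes_inv p \<sigma>)
  obtain m where m: "p ^^ Suc m = id" using obtain_period[OF p] .
  have mq: "q ^^ Suc m = id"
  proof
    fix x
    obtain y where "x = \<sigma> y" using permutes_surj[OF \<sigma>] by blast
    then show "(q ^^ Suc m) x = id x"
      unfolding q by (simp only: funpow_conjugate[OF permutes_bij[OF \<sigma>]] m id_apply)
  qed
  have words: "word p w (Suc m) i = word q w (Suc m) i" if "i \<in> {1..n}" for i
  proof (rule mono_on_eqI[OF _ mono_on_word[OF p ip mono] mono_on_word[OF qp iq mono] _ that])
    have "image_mset (word q w (Suc m)) (mset_set {1..n}) =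
        image_mset (word q w (Suc m) \<circ> \<sigma>) (mset_set {1..n})"
      by (rule image_mset_comp_permutes[OF \<sigma>, symmetric])
    also have "\<dots> = image_mset (word p w (Suc m)) (mset_set {1..n})"
      using word_conjugate[OF \<sigma> p, of _ w w] lab q
      by (intro image_mset_cong) (simp del: word.simps)
    finally show "image_mset (word p w (Suc m)) (mset_set {1..n}) =
        image_mset (word q w (Suc m)) (mset_set {1..n})" ..
  qed simp
  have last: "w (inv r j) = word r w (Suc m) j ! m"
    if "r permutes {1..n}" "r ^^ Suc m = id" for r j
  proof -
    have "r ((r ^^ m) j) = j" using fun_cong[OF that(2), of j] by simp
    then have "inv r j = (r ^^ m) j" using permutes_inv_eq[OF that(1)] by metis
    then show ?thesis by (simp add: nth_word del: word.simps)
  qed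
  \<comment> \<open>\<open>\<rho>\<close> measures the discrepancy between \<open>p\<close> and
    \<open>q\<close>. It is shown to be monotone, and a monotone permutation of
    \<open>{1..n}\<close> is the identity.\<close>
  define \<rho> where "\<rho> = inv q \<circ> p"
  have \<rho>: "\<rho> permutes {1..n}"
    unfolding \<rho>_def by (intro permutes_compose permutes_inv p qp)
  have q\<rho>: "q (\<rho> i) = p i" for i
    by (simp add: \<rho>_def permutes_inverses(1)[OF qp])
  have \<rho>_lab: "w (\<rho> i) = w i" if "i \<in> {1..n}" for i
  proof -
    have "p i \<in> {1..n}" using that permutes_in_image[OF p] by blast
    then have "w (inv q (p i)) = w (inv p (p i))"
      using last[OF p m] last[OF qp mq] words by metis
    then show ?thesis by (simp add: \<rho>_def permutes_inverses(2)[OF p])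
  qed
  have "mono_on {1..n} \<rho>"
  proof (rule mono_onI)
    fix i j assume ij: "i \<in> {1..n}" "j \<in> {1..n}" "i \<le> j"
    then have \<rho>ij: "\<rho> i \<in> {1..n}" "\<rho> j \<in> {1..n}" using permutes_in_image[OF \<rho>] by blast+
    show "\<rho> i \<le> \<rho> j"
    \<comment> \<open>An inversion of \<open>\<rho>\<close> would lie within one level of
      \<open>w\<close>, since \<open>w\<close> is monotone and \<open>\<rho>\<close> preserves
      labels. There \<open>q\<close> and \<open>p\<close> order the two images in opposite
      ways.\<close>
    proof (rule ccontr)
      assume "\<not> \<rho> i \<le> \<rho> j"
      then have gt: "\<rho> j < \<rho> i" by simp
      then have "w (\<rho> j) \<le> w (\<rho> i)" using mono_onD[OF mono] \<rho>ij gt by (meson less_imp_le)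
      moreover have "w i \<le> w j" using mono_onD[OF mono] ij by blast
      ultimately have eq: "w i = w j" using \<rho>_lab ij by simp
      then have "p j < p i"
        using iq gt \<rho>ij \<rho>_lab ij q\<rho> unfolding increasing_on_levels_def by metis
      moreover have "i \<noteq> j" using gt by auto
      ultimately show False
        using ip eq ij unfolding increasing_on_levels_def by (metis le_neq_implies_less less_asym)
    qed
  qed
  then have "\<rho> i = id i" if "i \<in> {1..n}" for i
    by (rule mono_on_eqI[OF finite_atLeastAtMost])
      (use that image_mset_comp_permutes[OF \<rho>, of id] in \<open>auto intro: mono_onI\<close>)
  then have "\<rho> i = i" for i
    using permutes_not_in[OF \<rho>] by (cases "i \<in> {1..n}") auto
  then show "p = q" using q\<rho> by (metis ext)
qed

text \<open>
  The standardizing conjugation sorts the points by itinerary; ties between different cycles are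
  broken by the least element of the cycle, a choice that \<open>p\<close> itself respects.
\<close>

lemma exists_conjugate_increasing_on_levels:
  fixes u w :: "nat \<Rightarrow> nat"
  assumes p: "p permutes {1..n}" and prim: "primitive_labelling n p u"
    and mono: "mono_on {1..n} w"
    and ms: "image_mset u (mset_set {1..n}) = image_mset w (mset_set {1..n})"
  obtains \<sigma> where "\<sigma> permutes {1..n}" "\<And>i. i \<in> {1..n} \<Longrightarrow> w (\<sigma> i) = u i"
    "increasing_on_levels n w (\<sigma> \<circ> p \<circ> inv \<sigma>)"
proof -
  obtain m where m: "p ^^ Suc m = id" using obtain_period[OF p] .
  have perm: "permutation p" using p permutation_permutes by blast
  define key where "key i = word p u (Suc m) i @ [Min (orbit p i)]" for i
  have "inj_on key {1..n}"
  proof (rule inj_onI)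
    fix i j assume ij: "i \<in> {1..n}" "j \<in> {1..n}" and "key i = key j"
    then have wd: "word p u (Suc m) i = word p u (Suc m) j"
      and mn: "Min (orbit p i) = Min (orbit p j)"
      by (auto simp: key_def simp del: word.simps)
    have fin: "finite (orbit p k)" "k \<in> orbit p k" for k
      using permutation_self_in_orbit[OF perm] finite_orbit by metis+
    then have "Min (orbit p i) \<in> orbit p i" "Min (orbit p j) \<in> orbit p j"
      by (metis Min_in emptyE)+
    then have "j \<in> orbit p i"
      using mn fin by (metis orbit_swap orbit_trans)
    \<comment> \<open>The keys compare the labels of one period only; reducing \<open>t\<close>
      modulo \<open>Suc m\<close> extends the agreement to all times.\<close>
    moreover have "u ((p ^^ t) i) = u ((p ^^ t) j)" for t
    proof -
      have "(p ^^ t) k = (p ^^ (t mod Suc m)) k" for k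
        by (rule funpow_mod_eq[symmetric]) (simp only: m id_apply)
      then show ?thesis
        using arg_cong[OF wd, of "\<lambda>l. l ! (t mod Suc m)"]
        by (simp add: nth_word del: word.simps)
    qed
    ultimately show "i = j" using prim ij by (simp add: primitive_labelling_def)
  qed
  then obtain \<sigma> where \<sigma>: "\<sigma> permutes {1..n}"
    and key: "\<And>i j. \<lbrakk>i \<in> {1..n}; j \<in> {1..n}\<rbrakk> \<Longrightarrow> \<sigma> i < \<sigma> j \<longleftrightarrow> key i < key j"
    using exists_ranking_permutation by blast
  have inv_in: "inv \<sigma> a \<in> {1..n}" if "a \<in> {1..n}" for a
    using that permutes_in_image[OF permutes_inv[OF \<sigma>]] by blast
  have \<sigma>_inv: "\<sigma> (inv \<sigma> a) = a" for a by (rule permutes_inverses(1)[OF \<sigma>])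
  have less_inv: "key (inv \<sigma> a) < key (inv \<sigma> b)" if "a \<in> {1..n}" "b \<in> {1..n}" "a < b" for a b
    using key[OF inv_in[OF that(1)] inv_in[OF that(2)]] that(3) by (simp add: \<sigma>_inv)
  \<comment> \<open>The label of a point is the first entry of its key, so sorting by key also sorts
    the labels. Having the same multiset as the monotone \<open>w\<close>, they then equal
    \<open>w\<close>.\<close>
  have "mono_on {1..n} (u \<circ> inv \<sigma>)"
  proof (rule mono_onI)
    fix a b assume ab: "a \<in> {1..n}" "b \<in> {1..n}" "a \<le> b"
    show "(u \<circ> inv \<sigma>) a \<le> (u \<circ> inv \<sigma>) b"
      using less_inv[OF ab(1,2)] ab(3) by (cases "a = b") (auto simp: key_def)
  qed
  moreover have "image_mset (u \<circ> inv \<sigma>) (mset_set {1..n}) = image_mset w (mset_set {1..n})"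
    using image_mset_comp_permutes[OF permutes_inv[OF \<sigma>]] ms by metis
  ultimately have uw: "(u \<circ> inv \<sigma>) a = w a" if "a \<in> {1..n}" for a
    by (rule mono_on_eqI[OF finite_atLeastAtMost _ mono _ that])
  have lab: "w (\<sigma> i) = u i" if "i \<in> {1..n}" for i
  proof -
    have "\<sigma> i \<in> {1..n}" using that permutes_in_image[OF \<sigma>] by blast
    from uw[OF this] show ?thesis by (simp add: permutes_inverses(2)[OF \<sigma>])
  qed
  \<comment> \<open>Since \<open>Suc m\<close> is a period, \<open>p\<close> rotates the word: the
    first label moves to the end, while the orbit minimum stays. Moving a common first label does
    not affect the comparison.\<close>
  have key_step: "key (p i) < key (p j)" if "key i < key j" "u i = u j" for i j
  proof -
    have "word p u (Suc m) (p k) = word p u m (p k) @ [u k]" for k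
      using fun_cong[OF m, of k] by (simp only: word_snoc) (simp add: funpow_swap1)
    moreover have "orbit p (p k) = orbit p k" for k
      by (rule permutation_orbit_step[OF perm])
    ultimately show ?thesis
      using that by (simp add: key_def append_less_append_iff del: word.simps(2))
        (simp add: append_less_append_iff)
  qed
  have "increasing_on_levels n w (\<sigma> \<circ> p \<circ> inv \<sigma>)"
    unfolding increasing_on_levels_def
  proof (intro ballI impI)
    fix a b assume ab: "a \<in> {1..n}" "b \<in> {1..n}" "a < b \<and> w a = w b"
    then have "key (p (inv \<sigma> a)) < key (p (inv \<sigma> b))"
      using uw by (intro key_step less_inv) auto
    then show "(\<sigma> \<circ> p \<circ> inv \<sigma>) a < (\<sigma> \<circ> p \<circ> inv \<sigma>) b"
      using key inv_in ab permutes_in_image[OF p] by simp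
  qed
  then show thesis using that \<sigma> lab by blast
qed

text \<open>Renaming by the injective \<open>\<tau>\<close> keeps the labelling primitive, so the
  points can be sorted afresh to suit \<open>w\<close>. Injectivity comes from uniqueness for the
  original labelling \<open>v\<close>.\<close>

lemma exists_cycle_structure_preserving_injection:
  fixes v w \<tau> :: "nat \<Rightarrow> nat"
  assumes mv: "mono_on {1..n} v" and mw: "mono_on {1..n} w" and \<tau>: "inj \<tau>"
    and ms: "image_mset (\<tau> \<circ> v) (mset_set {1..n}) = image_mset w (mset_set {1..n})"
  obtains f where "inj_on f {p. p permutes {1..n} \<and> increasing_on_levels n v p}"
    and "f ` {p. p permutes {1..n} \<and> increasing_on_levels n v p}
           \<subseteq> {q. q permutes {1..n} \<and> increasing_on_levels n w q}"
    and "\<And>p. p permutes {1..n} \<Longrightarrow> increasing_on_levels n v p \<Longrightarrow>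
           cycle_structure n (f p) = cycle_structure n p"
proof -
  define R where "R p \<sigma> \<longleftrightarrow> \<sigma> permutes {1..n} \<and> (\<forall>i\<in>{1..n}. w (\<sigma> i) = \<tau> (v i)) \<and>
    increasing_on_levels n w (\<sigma> \<circ> p \<circ> inv \<sigma>)" for p \<sigma>
  define s where "s p = (SOME \<sigma>. R p \<sigma>)" for p
  define f where "f p = s p \<circ> p \<circ> inv (s p)" for p
  let ?A = "{p. p permutes {1..n} \<and> increasing_on_levels n v p}"
  have R: "R p (s p)" if "p \<in> ?A" for p
  proof -
    have "primitive_labelling n p v"
      using increasing_on_levels_imp_primitive that by blast
    then have prim: "primitive_labelling n p (\<tau> \<circ> v)"
      using \<tau> by (simp add: primitive_labelling_def inj_eq)
    have "p permutes {1..n}" using that by blast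
    then obtain \<sigma> where "\<sigma> permutes {1..n}" "\<And>i. i \<in> {1..n} \<Longrightarrow> w (\<sigma> i) = (\<tau> \<circ> v) i"
      "increasing_on_levels n w (\<sigma> \<circ> p \<circ> inv \<sigma>)"
      using exists_conjugate_increasing_on_levels[OF _ prim mw ms] by blast
    then have "R p \<sigma>" by (simp add: R_def)
    then show ?thesis unfolding s_def by (rule someI[where P = "R p"])
  qed
  have "inj_on f ?A"
  proof (rule inj_onI)
    fix p p' assume pp: "p \<in> ?A" "p' \<in> ?A" and eq: "f p = f p'"
    \<comment> \<open>When the images coincide, going forward with \<open>s p\<close> and back with
      \<open>s p'\<close> conjugates \<open>p\<close> into \<open>p'\<close> and preserves
      \<open>v\<close>.\<close>
    define \<rho> where "\<rho> = inv (s p') \<circ> s p"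
    have sp: "s p permutes {1..n}" and sp': "s p' permutes {1..n}"
      using R pp by (auto simp: R_def)
    have \<rho>: "\<rho> permutes {1..n}"
      unfolding \<rho>_def by (intro permutes_compose permutes_inv sp sp')
    have s\<rho>: "s p' (\<rho> i) = s p i" for i
      by (simp add: \<rho>_def permutes_inverses[OF sp'])
    show "p = p'"
    proof (rule conjugate_increasing_on_levels_unique[OF _ _ mv \<rho>])
      fix i assume i: "i \<in> {1..n}"
      then have "\<rho> i \<in> {1..n}" using permutes_in_image[OF \<rho>] by blast
      then have "\<tau> (v (\<rho> i)) = w (s p' (\<rho> i))" using R[OF pp(2)] by (simp add: R_def)
      also have "\<dots> = \<tau> (v i)" using R[OF pp(1)] i by (simp add: R_def s\<rho>)
      finally show "v (\<rho> i) = v i" using \<tau> by (simp add: inj_eq)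
    next
      have "p' (\<rho> i) = \<rho> (p i)" for i
      proof -
        have "s p' (p' (\<rho> i)) = f p' (s p' (\<rho> i))"
          by (simp add: f_def permutes_inverses[OF sp'])
        also have "\<dots> = s p (p i)"
          unfolding s\<rho> eq[symmetric] by (simp add: f_def permutes_inverses[OF sp])
        finally show ?thesis
          using s\<rho> permutes_inj[OF sp'] by (metis injD)
      qed
      then show "p' = \<rho> \<circ> p \<circ> inv \<rho>"
        by (metis comp_apply ext permutes_inverses(1)[OF \<rho>])
    qed (use pp in auto)
  qed
  moreover have "f ` ?A \<subseteq> {q. q permutes {1..n} \<and> increasing_on_levels n w q}"
    using R by (auto simp: f_def R_def intro!: permutes_compose permutes_inv)
  moreover have "cycle_structure n (f p) = cycle_structure n p"
    if "p permutes {1..n}" "increasing_on_levels n v p" for p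
    unfolding f_def using cycle_structure_conjugate R that by (auto simp: R_def)
  ultimately show thesis using that by blast
qed

section \<open>Descent sets and blocks\<close>

text \<open>Blocks are numbered from 0, like list positions. The strict inequality leaves an element
  of \<open>I\<close> in the block that it closes.\<close>

definition block_index :: "nat set \<Rightarrow> nat \<Rightarrow> nat" where
  "block_index I i = card {x \<in> I. x < i}"

lemma mono_on_block_index: "finite I \<Longrightarrow> mono_on A (block_index I)"
  by (auto intro!: mono_onI card_mono simp: block_index_def)

lemma block_index_eq_iff:
  assumes "finite I" "i \<le> j"
  shows "block_index I i = block_index I j \<longleftrightarrow> I \<inter> {i..<j} = {}"
proof -
  have "{x \<in> I. x < j} = {x \<in> I. x < i} \<union> I \<inter> {i..<j}" using assms(2) by auto
  then have "block_index I j = block_index I i + card (I \<inter> {i..<j})"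
    unfolding block_index_def using assms(1) by (simp add: card_Un_disjoint disjoint_iff)
  then show ?thesis using assms(1) by simp
qed

lemma descent_set_subset_iff:
  assumes p: "p permutes {1..n}" and fin: "finite I"
  shows "descent_set n p \<subseteq> I \<longleftrightarrow> increasing_on_levels n (block_index I) p"
proof
  assume D: "descent_set n p \<subseteq> I"
  \<comment> \<open>Induction on the distance: no position from \<open>i\<close> up to the last step
    lies in \<open>I\<close>, so each step is an ascent; injectivity of \<open>p\<close> excludes
    equality.\<close>
  have "p i < p (i + Suc d)"
    if "1 \<le> i" "i + Suc d \<le> n" "I \<inter> {i..<i + Suc d} = {}" for i d
    using that
  proof (induction d)
    case 0
    then have "i \<notin> descent_set n p" using D by auto
    moreover have "p i \<noteq> p (i + 1)" using permutes_inj[OF p] by (simp add: inj_eq)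
    ultimately show ?case using 0 by (auto simp: descent_set_def)
  next
    case (Suc d)
    let ?k = "i + Suc d"
    have "p i < p ?k" using Suc by fastforce
    moreover have "?k \<notin> descent_set n p" using D Suc.prems by auto
    moreover have "p ?k \<noteq> p (?k + 1)" using permutes_inj[OF p] by (simp add: inj_eq)
    ultimately show ?case using Suc.prems by (auto simp: descent_set_def)
  qed
  then have less: "p i < p j" if "1 \<le> i" "i < j" "j \<le> n" "I \<inter> {i..<j} = {}" for i j
    using that by (metis add_Suc_right less_imp_Suc_add)
  show "increasing_on_levels n (block_index I) p"
    unfolding increasing_on_levels_def
  proof (intro ballI impI)
    fix i j
    assume "i \<in> {1..n}" "j \<in> {1..n}" "i < j \<and> block_index I i = block_index I j"
    then show "p i < p j" using block_index_eq_iff[OF fin, of i j] by (intro less) auto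
  qed
next
  assume inc: "increasing_on_levels n (block_index I) p"
  show "descent_set n p \<subseteq> I"
  proof
    fix i assume i: "i \<in> descent_set n p"
    show "i \<in> I"
    proof (rule ccontr)
      assume "i \<notin> I"
      then have "block_index I i = block_index I (i + 1)"
        using block_index_eq_iff[OF fin, of i "i + 1"] by auto
      moreover have "i \<in> {1..n}" "i + 1 \<in> {1..n}" using i by (auto simp: descent_set_def)
      ultimately have "p i < p (i + 1)" using inc by (simp add: increasing_on_levels_def)
      then show False using i by (simp add: descent_set_def)
    qed
  qed
qed

text \<open>The starting point \<open>a\<close> is kept general because the induction removes the
  first entry \<open>y\<close> and restarts from it.\<close>

lemma nth_differences:
  fixes a n :: nat
  assumes "sorted_wrt (<) (a # xs @ [n])" "c \<le> length xs"
  shows "map2 (\<lambda>x y. y - x) (a # xs) (xs @ [n]) ! c =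
    card {i \<in> {a<..n}. length (filter (\<lambda>x. x < i) xs) = c}"
  using assms
proof (induction xs arbitrary: a c)
  case Nil
  moreover have "{i. a < i \<and> i \<le> n} = {a<..n}" by auto
  ultimately show ?case by simp
next
  case (Cons y ys)
  have sep: "y < x" if "x \<in> set ys" for x using that Cons.prems by auto
  have ay: "a < y" and yn: "y < n" using Cons.prems by auto
  define g where "g i = length (filter (\<lambda>x. x < i) ys)" for i
  define h where "h i = length (filter (\<lambda>x. x < i) (y # ys))" for i
  \<comment> \<open>Up to and including \<open>y\<close> no entry is counted; beyond
    \<open>y\<close> the entry \<open>y\<close> adds one. So index 0 describes the points up to
    \<open>y\<close>, and all later indices shift by one.\<close>
  have low: "h i = 0" if "i \<le> y" for i
  proof -
    have "\<not> x < i" if "x \<in> set (y # ys)" for x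
      using that sep[of x] \<open>i \<le> y\<close> by auto
    then show ?thesis by (simp add: h_def filter_empty_conv)
  qed
  have high: "h i = Suc (g i)" if "y < i" for i
    using that by (simp add: h_def g_def)
  have "map2 (\<lambda>x y. y - x) (a # y # ys) ((y # ys) @ [n]) ! c = card {i \<in> {a<..n}. h i = c}"
  proof (cases c)
    case 0
    have iff: "h i = 0 \<longleftrightarrow> i \<le> y" for i
      using low[of i] high[of i] by (cases "i \<le> y") auto
    have "{i \<in> {a<..n}. h i = 0} = {a<..y}"
      unfolding iff using yn by auto
    then show ?thesis by (simp add: 0)
  next
    case (Suc c')
    have iff: "h i = Suc c' \<longleftrightarrow> y < i \<and> g i = c'" for i
      using low[of i] high[of i] by (cases "i \<le> y") auto
    have eq: "{i \<in> {a<..n}. h i = Suc c'} = {i \<in> {y<..n}. g i = c'}"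
      unfolding iff using ay by auto
    have "map2 (\<lambda>x y. y - x) (y # ys) (ys @ [n]) ! c' = card {i \<in> {y<..n}. g i = c'}"
      unfolding g_def using Cons.prems by (intro Cons.IH) (auto simp: Suc)
    then show ?thesis unfolding Suc eq by simp
  qed
  then show ?case unfolding h_def .
qed

lemma length_associated_composition: "length (associated_composition n I) = Suc (card I)"
  by (simp add: associated_composition_def Let_def)

lemma nth_associated_composition:
  assumes "n \<ge> 1" "I \<subseteq> {1..n - 1}" "c \<le> card I"
  shows "associated_composition n I ! c = card {i \<in> {1..n}. block_index I i = c}"
proof -
  let ?xs = "sorted_list_of_set I"
  have fin: "finite I" using assms(2) finite_subset by blast
  have "block_index I i = length (filter (\<lambda>x. x < i) ?xs)" for i
  proof -
    have "block_index I i = card (set (filter (\<lambda>x. x < i) ?xs))"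
      using fin by (simp add: block_index_def)
    also have "\<dots> = length (filter (\<lambda>x. x < i) ?xs)"
      by (intro distinct_card distinct_filter) simp
    finally show ?thesis .
  qed
  \<comment> \<open>For empty \<open>I\<close> strictness amounts to \<open>0 < n\<close>, which is
    where \<open>n \<ge> 1\<close> enters.\<close>
  moreover have "sorted_wrt (<) (0 # ?xs @ [n])"
    using assms(1) fin subsetD[OF assms(2)] by (fastforce simp: sorted_wrt_append)
  moreover have "{1..n} = {0<..n}" by auto
  ultimately show ?thesis
    using nth_differences[of 0 ?xs n c] assms(3) fin
    by (simp add: associated_composition_def Let_def)
qed

section \<open>Matching the blocks of two subsets by size\<close>

lemma image_mset_eqI_card:
  assumes "finite A" "\<And>d. card {i \<in> A. f i = d} = card {i \<in> A. g i = d}"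
  shows "image_mset f (mset_set A) = image_mset g (mset_set A)"
proof (rule multiset_eqI)
  fix d
  have "f -` {d} \<inter> A = {i \<in> A. f i = d}" "g -` {d} \<inter> A = {i \<in> A. g i = d}" by auto
  then show "count (image_mset f (mset_set A)) d = count (image_mset g (mset_set A)) d"
    using assms by (simp add: count_image_mset)
qed

text \<open>Equal partitions mean that the two compositions are rearrangements of each other; the
  permutation of positions realizing this renames the blocks.\<close>

lemma exists_block_relabelling:
  assumes "n \<ge> 1" and I: "I \<subseteq> {1..n - 1}" and J: "J \<subseteq> {1..n - 1}"
    and eq: "associated_partition n I = associated_partition n J"
  obtains \<tau> where "inj \<tau>"
    "image_mset (\<tau> \<circ> block_index I) (mset_set {1..n}) =
     image_mset (block_index J) (mset_set {1..n})"
proof -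
  let ?a = "associated_composition n I" and ?b = "associated_composition n J"
  have ms: "mset ?a = mset ?b"
    using eq unfolding associated_partition_def by (metis mset_rev mset_sort)
  then obtain \<tau> where \<tau>: "\<tau> permutes {..<length ?b}" and pl: "permute_list \<tau> ?b = ?a"
    by (rule mset_eq_permutation)
  have len: "card I = card J"
    using mset_eq_length[OF ms] by (simp add: length_associated_composition)
  have fin: "finite I" "finite J" using I J finite_subset by blast+
  have le: "block_index I i \<le> card I" "block_index J i \<le> card J" for i
    unfolding block_index_def using fin by (auto intro!: card_mono)
  have "card {i \<in> {1..n}. (\<tau> \<circ> block_index I) i = d} = card {i \<in> {1..n}. block_index J i = d}" for d
  proof -
    obtain c where d: "d = \<tau> c" using permutes_surj[OF \<tau>] by blast
    have *: "{i \<in> {1..n}. (\<tau> \<circ> block_index I) i = d} = {i \<in> {1..n}. block_index I i = c}"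
      using permutes_inj[OF \<tau>] by (auto simp: d inj_eq)
    show ?thesis
    proof (cases "c \<le> card I")
      case True
      then have c: "c < length ?b" by (simp add: len length_associated_composition)
      then have "d < length ?b" using permutes_in_image[OF \<tau>, of c] by (simp add: d)
      then have "d \<le> card J" by (simp add: length_associated_composition)
      then show ?thesis
        unfolding * using permute_list_nth[OF \<tau> c] True nth_associated_composition[OF assms(1) I]
          nth_associated_composition[OF assms(1) J] by (metis pl d)
    next
      \<comment> \<open>Beyond the last block \<open>\<tau>\<close> is the identity, and no point
        carries such an index on either side.\<close>
      case False
      then have "d = c" unfolding d
        by (intro permutes_not_in[OF \<tau>]) (simp add: len length_associated_composition)
      then have "{i \<in> {1..n}. block_index I i = c} = {}" "{i \<in> {1..n}. block_index J i = d} = {}"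
        using False le len by (metis (mono_tags, lifting) empty_Collect_eq)+
      then show ?thesis unfolding * by (simp only: card.empty)
    qed
  qed
  then show thesis
    using that permutes_inj[OF \<tau>] image_mset_eqI_card[OF finite_atLeastAtMost] by blast
qed

section \<open>Injections between descent classes\<close>

lemma exists_descent_class_injection:
  assumes "n \<ge> 1" and I: "I \<subseteq> {1..n - 1}" and J: "J \<subseteq> {1..n - 1}"
    and "associated_partition n I = associated_partition n J"
  obtains f where "inj_on f {p. p permutes {1..n} \<and> descent_set n p \<subseteq> I}"
    and "f ` {p. p permutes {1..n} \<and> descent_set n p \<subseteq> I}
           \<subseteq> {q. q permutes {1..n} \<and> descent_set n q \<subseteq> J}"
    and "\<forall>p. p permutes {1..n} \<and> descent_set n p \<subseteq> I \<longrightarrow>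
           cycle_structure n (f p) = cycle_structure n p"
proof -
  have fin: "finite I" "finite J" using I J finite_subset by blast+
  have eq: "{p. p permutes {1..n} \<and> descent_set n p \<subseteq> K} =
      {p. p permutes {1..n} \<and> increasing_on_levels n (block_index K) p}" if "finite K" for K
    using descent_set_subset_iff[OF _ that] by blast
  obtain \<tau> where "inj \<tau>" and "image_mset (\<tau> \<circ> block_index I) (mset_set {1..n}) =
     image_mset (block_index J) (mset_set {1..n})"
    using exists_block_relabelling[OF assms] .
  then obtain f where "inj_on f {p. p permutes {1..n} \<and> increasing_on_levels n (block_index I) p}"
    "f ` {p. p permutes {1..n} \<and> increasing_on_levels n (block_index I) p}
       \<subseteq> {q. q permutes {1..n} \<and> increasing_on_levels n (block_index J) q}"
    "\<And>p. p permutes {1..n} \<Longrightarrow> increasing_on_levels n (block_index I) p \<Longrightarrow>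
       cycle_structure n (f p) = cycle_structure n p"
    using exists_cycle_structure_preserving_injection[OF mono_on_block_index[OF fin(1)]
        mono_on_block_index[OF fin(2)]] by blast
  then show thesis
    by (intro that[of f]) (use descent_set_subset_iff fin eq in auto)
qed

theorem proposition5p2:
  fixes n :: nat and I J :: "nat set"
  assumes "n \<ge> 1"
    and "I \<subseteq> {1..n - 1}" and "J \<subseteq> {1..n - 1}"
    and "associated_partition n I = associated_partition n J"
  shows "\<exists>f. bij_betw f {p. p permutes {1..n} \<and> descent_set n p \<subseteq> I}
                      {q. q permutes {1..n} \<and> descent_set n q \<subseteq> J}
           \<and> (\<forall>p. p permutes {1..n} \<and> descent_set n p \<subseteq> I
                   \<longrightarrow> cycle_structure n (f p) = cycle_structure n p)"
proof -
  let ?A = "{p. p permutes {1..n} \<and> descent_set n p \<subseteq> I}"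
  let ?B = "{q. q permutes {1..n} \<and> descent_set n q \<subseteq> J}"
  have fin: "finite ?A" "finite ?B"
    by (rule finite_subset[OF _ finite_permutations[of "{1..n}"]]; auto)+
  obtain f where f: "inj_on f ?A" "f ` ?A \<subseteq> ?B"
    "\<forall>p. p permutes {1..n} \<and> descent_set n p \<subseteq> I \<longrightarrow> cycle_structure n (f p) = cycle_structure n p"
    using exists_descent_class_injection[OF assms] .
  \<comment> \<open>Exchanging \<open>I\<close> and \<open>J\<close> gives an injection the other
    way. As both sets are finite, their cardinalities agree and \<open>f\<close> is onto.\<close>
  obtain g where "inj_on g ?B" "g ` ?B \<subseteq> ?A"
    using exists_descent_class_injection[OF assms(1,3,2) assms(4)[symmetric]] .
  then have "card ?B \<le> card ?A" using fin by (intro card_inj_on_le)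
  then have "f ` ?A = ?B"
    using f fin by (intro card_seteq) (simp_all add: card_image)
  then show ?thesis using f by (auto simp: bij_betw_def)
qed

end
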